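(* Let $Y$ be a set with $|Y|\geq 2$ (equivalently, such that the free quandle $\operatorname{Free}Y$ generated by $Y$ is nontrivial). Then $\operatorname{Free}Y$ has no good involutions, that is, $\operatorname{Good}(\operatorname{Free}Y)=\emptyset$.
   Context: A quandle is a pair $(X,s)$ where $X$ is a set and $s:X\to S_X$, $x\mapsto s_x$, is a function to the symmetric group $S_X$ such that $s_xs_y=s_{s_x(y)}s_x$ and $s_x(x)=x$ for all $x,y\in X$. It is trivial if $s_x=\mathrm{id}_X$ for all $x\in X$. The free quandle $\operatorname{Free}Y$ on a set $Y$ is the image of $Y$ under the left adjoint of the forgetful functor from quandles to sets. Explicitly, with $F(Y)$ the free group on $Y$, $\operatorname{Free}Y$ may be identified with the set of all conjugates in $F(Y)$ of elements of $Y$, with quandle structure $s_g(h):=ghg^{-1}$. A good involution of a quandle $(X,s)$ is a permutation $\rho\in S_X$ with $\rho^2=\mathrm{id}_X$ (the identity map is allowed) such that $\rho s_x=s_x\rho$ and $s_{\rho(x)}=s_x^{-1}$ for all $x\in X$. $\operatorname{Good}Q$ denotes the set of all good involutions of $Q$. *)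

theory Defs
  imports "HOL-Algebra.Bij"
begin

section \<open>Quandles\<close>

text \<open>The symmetric group of a set \<open>X\<close> is \<^term>\<open>BijGroup X\<close>: its elements are extensional functions,
  so equality of permutations means equality on \<open>X\<close>, and \<open>p \<otimes> q\<close> is \<open>p\<close> after \<open>q\<close>.\<close>

record 'a quandle = "'a partial_object" +
  symm :: "'a \<Rightarrow> 'a \<Rightarrow> 'a"  ("\<s>\<index>")

locale quandle =
  fixes Q (structure)
  assumes symm_closed: "x \<in> carrier Q \<Longrightarrow> \<s> x \<in> carrier (BijGroup (carrier Q))"
    and symm_symm: "\<lbrakk>x \<in> carrier Q; y \<in> carrier Q\<rbrakk> \<Longrightarrow>
      \<s> x \<otimes>\<^bsub>BijGroup (carrier Q)\<^esub> \<s> y = \<s> (\<s> x y) \<otimes>\<^bsub>BijGroup (carrier Q)\<^esub> \<s> x"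
    and symm_self: "x \<in> carrier Q \<Longrightarrow> \<s> x x = x"

definition trivial_quandle :: "('a, 'b) quandle_scheme \<Rightarrow> bool"
  where "trivial_quandle Q \<longleftrightarrow> (\<forall>x\<in>carrier Q. \<s>\<^bsub>Q\<^esub> x = \<one>\<^bsub>BijGroup (carrier Q)\<^esub>)"

definition good_involution :: "('a, 'b) quandle_scheme \<Rightarrow> ('a \<Rightarrow> 'a) \<Rightarrow> bool"
  where "good_involution Q \<rho> \<longleftrightarrow>
    (let S = BijGroup (carrier Q) in
      \<rho> \<in> carrier S \<and> \<rho> \<otimes>\<^bsub>S\<^esub> \<rho> = \<one>\<^bsub>S\<^esub> \<and>
      (\<forall>x\<in>carrier Q. \<rho> \<otimes>\<^bsub>S\<^esub> \<s>\<^bsub>Q\<^esub> x = \<s>\<^bsub>Q\<^esub> x \<otimes>\<^bsub>S\<^esub> \<rho> \<and> \<s>\<^bsub>Q\<^esub> (\<rho> x) = inv\<^bsub>S\<^esub> (\<s>\<^bsub>Q\<^esub> x)))"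

definition Good :: "('a, 'b) quandle_scheme \<Rightarrow> ('a \<Rightarrow> 'a) set"
  where "Good Q = {\<rho>. good_involution Q \<rho>}"


section \<open>Free groups\<close>

text \<open>The free group on \<open>Y\<close> is realised by reduced words. The letter \<open>(y, True)\<close> stands for the
  generator \<open>y\<close> and \<open>(y, False)\<close> for its inverse.\<close>

type_synonym 'a word = "('a \<times> bool) list"

definition inv_letter :: "'a \<times> bool \<Rightarrow> 'a \<times> bool"
  where "inv_letter a = (fst a, \<not> snd a)"

definition reduced :: "'a word \<Rightarrow> bool"
  where "reduced w \<longleftrightarrow> (\<forall>i. Suc i < length w \<longrightarrow> w ! Suc i \<noteq> inv_letter (w ! i))"

text \<open>\<open>red_cons a w\<close> is the reduced form of \<open>a # w\<close> when \<open>w\<close> is reduced; hence for reduced \<open>u\<close> and \<open>v\<close>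
  the reduced form of \<open>u @ v\<close> is \<open>foldr red_cons u v\<close>.\<close>

fun red_cons :: "'a \<times> bool \<Rightarrow> 'a word \<Rightarrow> 'a word"
  where
    "red_cons a [] = [a]"
  | "red_cons a (b # w) = (if b = inv_letter a then w else a # b # w)"

definition free_group :: "'a set \<Rightarrow> 'a word monoid"
  where "free_group Y =
    \<lparr>carrier = {w \<in> lists (Y \<times> UNIV). reduced w},
     mult = \<lambda>u v. foldr red_cons u v,
     one = []\<rparr>"

definition generator :: "'a \<Rightarrow> 'a word"
  where "generator y = [(y, True)]"


section \<open>Free quandles\<close>

text \<open>The value at \<open>Y\<close> of the left adjoint of the forgetful functor from quandles to sets, in its
  standard model: the conjugates of the generators in the free group, under conjugation.\<close>

definition free_quandle :: "'a set \<Rightarrow> 'a word quandle"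
  where "free_quandle Y =
    (let F = free_group Y;
         C = {g \<otimes>\<^bsub>F\<^esub> generator y \<otimes>\<^bsub>F\<^esub> inv\<^bsub>F\<^esub> g | g y. g \<in> carrier F \<and> y \<in> Y}
     in \<lparr>carrier = C, symm = (\<lambda>g\<in>C. \<lambda>h\<in>C. g \<otimes>\<^bsub>F\<^esub> h \<otimes>\<^bsub>F\<^esub> inv\<^bsub>F\<^esub> g)\<rparr>)"


section \<open>Free groups are groups and free quandles are quandles\<close>

lemma inv_letter_inv_letter [simp]: "inv_letter (inv_letter a) = a"
  by (simp add: inv_letter_def)

lemma reduced_Nil [simp]: "reduced []"
  by (simp add: reduced_def)

lemma reduced_single [simp]: "reduced [a]"
  by (simp add: reduced_def)

lemma reduced_Cons_Cons [simp]:
  "reduced (a # b # w) \<longleftrightarrow> b \<noteq> inv_letter a \<and> reduced (b # w)"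
proof
  assume L: "reduced (a # b # w)"
  have "b \<noteq> inv_letter a"
    using L[unfolded reduced_def, rule_format, of 0] by simp
  moreover have "reduced (b # w)"
    unfolding reduced_def
  proof (intro allI impI)
    fix i assume "Suc i < length (b # w)"
    then show "(b # w) ! Suc i \<noteq> inv_letter ((b # w) ! i)"
      using L[unfolded reduced_def, rule_format, of "Suc i"] by simp
  qed
  ultimately show "b \<noteq> inv_letter a \<and> reduced (b # w)" ..
next
  assume R: "b \<noteq> inv_letter a \<and> reduced (b # w)"
  show "reduced (a # b # w)"
    unfolding reduced_def
  proof (intro allI impI)
    fix i assume "Suc i < length (a # b # w)"
    then show "(a # b # w) ! Suc i \<noteq> inv_letter ((a # b # w) ! i)"
      using R by (cases i) (auto simp: reduced_def)
  qed
qed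

lemma reduced_tl: "reduced (a # w) \<Longrightarrow> reduced w"
  by (cases w) auto

lemma reduced_red_cons: "reduced w \<Longrightarrow> reduced (red_cons a w)"
  by (cases w) (auto dest: reduced_tl)

lemma reduced_foldr: "reduced v \<Longrightarrow> reduced (foldr red_cons u v)"
  by (induction u) (auto intro: reduced_red_cons)

lemma red_cons_cancel: "reduced w \<Longrightarrow> red_cons (inv_letter a) (red_cons a w) = w"
  by (cases w rule: remdups_adj.cases) auto

lemma foldr_red_cons_step:
  assumes "reduced w"
  shows "foldr red_cons (red_cons a x) w = red_cons a (foldr red_cons x w)"
proof (cases x)
  case (Cons b y)
  then show ?thesis
    using red_cons_cancel[OF reduced_foldr[OF assms, of y], of b] by auto
qed simp

lemma foldr_red_cons_assoc:
  "reduced w \<Longrightarrow>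
    foldr red_cons (foldr red_cons u v) w = foldr red_cons u (foldr red_cons v w)"
  by (induction u) (auto simp: foldr_red_cons_step)

lemma foldr_red_cons_Nil: "reduced u \<Longrightarrow> foldr red_cons u [] = u"
proof (induction u)
  case (Cons a u)
  then show ?case by (cases u) (auto dest: reduced_tl)
qed simp

lemma red_cons_lists:
  "a \<in> A \<Longrightarrow> w \<in> lists A \<Longrightarrow> red_cons a w \<in> lists A"
  by (cases w) auto

lemma foldr_red_cons_lists:
  "u \<in> lists A \<Longrightarrow> v \<in> lists A \<Longrightarrow> foldr red_cons u v \<in> lists A"
  by (induction u) (simp_all add: red_cons_lists del: in_lists_conv_set)

lemma foldr_red_cons_rev:
  "reduced w \<Longrightarrow> foldr red_cons (rev (map inv_letter u)) (foldr red_cons u w) = w"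
  by (induction u) (auto simp: red_cons_cancel reduced_foldr)

lemma group_free_group: "group (free_group Y)"
proof (rule groupI)
  fix u assume u: "u \<in> carrier (free_group Y)"
  define v where "v = foldr red_cons (rev (map inv_letter u)) []"
  have "rev (map inv_letter u) \<in> lists (Y \<times> UNIV)"
    using u by (fastforce simp: free_group_def inv_letter_def)
  then have "v \<in> carrier (free_group Y)"
    by (simp add: free_group_def v_def reduced_foldr foldr_red_cons_lists)
  moreover have "v \<otimes>\<^bsub>free_group Y\<^esub> u = \<one>\<^bsub>free_group Y\<^esub>"
    using u foldr_red_cons_rev[of "[]" u]
    by (simp add: free_group_def v_def foldr_red_cons_assoc foldr_red_cons_Nil)
  ultimately show "\<exists>v\<in>carrier (free_group Y). v \<otimes>\<^bsub>free_group Y\<^esub> u = \<one>\<^bsub>free_group Y\<^esub>" ..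
qed (simp_all add: free_group_def reduced_foldr foldr_red_cons_lists foldr_red_cons_assoc)

lemma generator_closed: "y \<in> Y \<Longrightarrow> generator y \<in> carrier (free_group Y)"
  by (simp add: free_group_def generator_def)

lemma quandle_free_quandle: "quandle (free_quandle Y)"
proof -
  define F where "F = free_group Y"
  interpret group F unfolding F_def by (rule group_free_group)
  define C where "C = {g \<otimes>\<^bsub>F\<^esub> generator y \<otimes>\<^bsub>F\<^esub> inv\<^bsub>F\<^esub> g | g y. g \<in> carrier F \<and> y \<in> Y}"
  have Q: "free_quandle Y =
      \<lparr>carrier = C, symm = (\<lambda>g\<in>C. \<lambda>h\<in>C. g \<otimes>\<^bsub>F\<^esub> h \<otimes>\<^bsub>F\<^esub> inv\<^bsub>F\<^esub> g)\<rparr>"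
    unfolding free_quandle_def F_def C_def Let_def ..
  have gen: "generator y \<in> carrier F" if "y \<in> Y" for y
    using that by (simp add: F_def generator_closed)
  have CF: "x \<in> carrier F" if "x \<in> C" for x
    using that by (auto simp: C_def gen)
  have conj: "g \<otimes>\<^bsub>F\<^esub> h \<otimes>\<^bsub>F\<^esub> inv\<^bsub>F\<^esub> g \<in> C" if g: "g \<in> carrier F" and h: "h \<in> C" for g h
  proof -
    from h obtain k y where k: "k \<in> carrier F" and y: "y \<in> Y"
      and [simp]: "h = k \<otimes>\<^bsub>F\<^esub> generator y \<otimes>\<^bsub>F\<^esub> inv\<^bsub>F\<^esub> k"
      by (auto simp: C_def)
    have "g \<otimes>\<^bsub>F\<^esub> h \<otimes>\<^bsub>F\<^esub> inv\<^bsub>F\<^esub> g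
        = (g \<otimes>\<^bsub>F\<^esub> k) \<otimes>\<^bsub>F\<^esub> generator y \<otimes>\<^bsub>F\<^esub> inv\<^bsub>F\<^esub> (g \<otimes>\<^bsub>F\<^esub> k)"
      using g k gen[OF y] by (simp add: m_assoc inv_mult_group)
    moreover have "g \<otimes>\<^bsub>F\<^esub> k \<in> carrier F" using g k by simp
    ultimately show ?thesis using y unfolding C_def by blast
  qed
  have left: "g \<otimes>\<^bsub>F\<^esub> (inv\<^bsub>F\<^esub> g \<otimes>\<^bsub>F\<^esub> h) = h" "inv\<^bsub>F\<^esub> g \<otimes>\<^bsub>F\<^esub> (g \<otimes>\<^bsub>F\<^esub> h) = h"
    if "g \<in> carrier F" "h \<in> carrier F" for g h
    using that by (simp_all add: m_assoc [symmetric])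
  have bij: "(\<lambda>h\<in>C. g \<otimes>\<^bsub>F\<^esub> h \<otimes>\<^bsub>F\<^esub> inv\<^bsub>F\<^esub> g) \<in> Bij C" if g: "g \<in> C" for g
  proof -
    have "bij_betw (\<lambda>h. g \<otimes>\<^bsub>F\<^esub> h \<otimes>\<^bsub>F\<^esub> inv\<^bsub>F\<^esub> g) C C"
    proof (rule bij_betw_byWitness[where f' = "\<lambda>h. inv\<^bsub>F\<^esub> g \<otimes>\<^bsub>F\<^esub> h \<otimes>\<^bsub>F\<^esub> g"])
      show "(\<lambda>h. inv\<^bsub>F\<^esub> g \<otimes>\<^bsub>F\<^esub> h \<otimes>\<^bsub>F\<^esub> g) ` C \<subseteq> C"
        using conj[of "inv\<^bsub>F\<^esub> g"] CF[OF g] by auto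
    qed (use CF g conj in \<open>auto simp: m_assoc left\<close>)
    then show ?thesis by (simp add: Bij_def)
  qed
  show ?thesis
  proof
    fix x assume x: "x \<in> carrier (free_quandle Y)"
    show "\<s>\<^bsub>free_quandle Y\<^esub> x \<in> carrier (BijGroup (carrier (free_quandle Y)))"
      using x bij by (simp add: Q BijGroup_def)
    show "\<s>\<^bsub>free_quandle Y\<^esub> x x = x"
      using x by (simp add: Q CF m_assoc)
    fix y assume y: "y \<in> carrier (free_quandle Y)"
    show "\<s>\<^bsub>free_quandle Y\<^esub> x \<otimes>\<^bsub>BijGroup (carrier (free_quandle Y))\<^esub> \<s>\<^bsub>free_quandle Y\<^esub> y =
      \<s>\<^bsub>free_quandle Y\<^esub> (\<s>\<^bsub>free_quandle Y\<^esub> x y)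
        \<otimes>\<^bsub>BijGroup (carrier (free_quandle Y))\<^esub> \<s>\<^bsub>free_quandle Y\<^esub> x"
    proof -
      define z where "z = x \<otimes>\<^bsub>F\<^esub> y \<otimes>\<^bsub>F\<^esub> inv\<^bsub>F\<^esub> x"
      have C: "x \<in> C" "y \<in> C" using x y by (simp_all add: Q)
      then have z: "z \<in> C" by (simp add: z_def conj CF)
      have "compose C (\<lambda>h\<in>C. x \<otimes>\<^bsub>F\<^esub> h \<otimes>\<^bsub>F\<^esub> inv\<^bsub>F\<^esub> x) (\<lambda>h\<in>C. y \<otimes>\<^bsub>F\<^esub> h \<otimes>\<^bsub>F\<^esub> inv\<^bsub>F\<^esub> y)
          = compose C (\<lambda>h\<in>C. z \<otimes>\<^bsub>F\<^esub> h \<otimes>\<^bsub>F\<^esub> inv\<^bsub>F\<^esub> z) (\<lambda>h\<in>C. x \<otimes>\<^bsub>F\<^esub> h \<otimes>\<^bsub>F\<^esub> inv\<^bsub>F\<^esub> x)"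
        unfolding compose_def
      proof (rule restrict_ext)
        fix h assume h: "h \<in> C"
        have "x \<otimes>\<^bsub>F\<^esub> (y \<otimes>\<^bsub>F\<^esub> h \<otimes>\<^bsub>F\<^esub> inv\<^bsub>F\<^esub> y) \<otimes>\<^bsub>F\<^esub> inv\<^bsub>F\<^esub> x
            = z \<otimes>\<^bsub>F\<^esub> (x \<otimes>\<^bsub>F\<^esub> h \<otimes>\<^bsub>F\<^esub> inv\<^bsub>F\<^esub> x) \<otimes>\<^bsub>F\<^esub> inv\<^bsub>F\<^esub> z"
          using C h by (simp add: z_def CF m_assoc inv_mult_group left)
        then show "(\<lambda>h\<in>C. x \<otimes>\<^bsub>F\<^esub> h \<otimes>\<^bsub>F\<^esub> inv\<^bsub>F\<^esub> x) ((\<lambda>h\<in>C. y \<otimes>\<^bsub>F\<^esub> h \<otimes>\<^bsub>F\<^esub> inv\<^bsub>F\<^esub> y) h)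
            = (\<lambda>h\<in>C. z \<otimes>\<^bsub>F\<^esub> h \<otimes>\<^bsub>F\<^esub> inv\<^bsub>F\<^esub> z) ((\<lambda>h\<in>C. x \<otimes>\<^bsub>F\<^esub> h \<otimes>\<^bsub>F\<^esub> inv\<^bsub>F\<^esub> x) h)"
          using C h by (simp add: conj CF)
      qed
      then show ?thesis
        using C z bij by (simp add: Q BijGroup_def z_def [symmetric])
    qed
  qed
qed

end

theory Submission
  imports Defs
begin

text \<open>Suppose that \<open>\<rho>\<close> is a good involution of the free quandle on \<open>Y\<close>. For an element \<open>x\<close>, the
  equation \<open>s (\<rho> x) = inv (s x)\<close> says that conjugation by \<open>g = \<rho> x \<otimes> x\<close> fixes every conjugate of a
  generator, so that \<open>g\<close> commutes with all generators. If \<open>Y\<close> has two elements, then this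
  forces \<open>g = \<one>\<close> (lemma \<open>commutes_two_letters_Nil\<close>). But \<open>\<rho> x\<close> and \<open>x\<close> are both conjugates of
  generators, so each of them has exponent sum 1 (lemma \<open>expsum_free_quandle\<close>), and \<open>g\<close> has exponent
  sum 2, whereas \<open>\<one>\<close> has exponent sum 0.

  The identity is a good involution of every trivial quandle. Hence the free quandle on at least
  two generators is not trivial either. Conversely, a free group on at most one generator is
  abelian, so the corresponding free quandle is trivial.\<close>


lemma (in quandle) good_involution_inverse:
  assumes \<rho>: "good_involution Q \<rho>" and x: "x \<in> carrier Q"
  shows "\<rho> x \<in> carrier Q"
    and "h \<in> carrier Q \<Longrightarrow> \<s> (\<rho> x) (\<s> x h) = h"
proof -
  interpret S: group "BijGroup (carrier Q)" by (rule group_BijGroup)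
  have "\<rho> \<in> Bij (carrier Q)"
    using \<rho> by (simp add: good_involution_def BijGroup_def Let_def)
  then show \<rho>x: "\<rho> x \<in> carrier Q"
    using x Bij_imp_funcset by blast
  have "\<s> (\<rho> x) = inv\<^bsub>BijGroup (carrier Q)\<^esub> (\<s> x)"
    using \<rho> x by (simp add: good_involution_def Let_def)
  then have "\<s> (\<rho> x) \<otimes>\<^bsub>BijGroup (carrier Q)\<^esub> \<s> x = \<one>\<^bsub>BijGroup (carrier Q)\<^esub>"
    using symm_closed[OF x] by simp
  then have eq: "compose (carrier Q) (\<s> (\<rho> x)) (\<s> x) = (\<lambda>x\<in>carrier Q. x)"
    using symm_closed[OF x] symm_closed[OF \<rho>x] by (simp add: BijGroup_def)
  show "\<s> (\<rho> x) (\<s> x h) = h" if "h \<in> carrier Q"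
    using fun_cong[OF eq, of h] that by (simp add: compose_def)
qed

lemma good_involution_trivial_quandle:
  assumes "trivial_quandle Q"
  shows "good_involution Q \<one>\<^bsub>BijGroup (carrier Q)\<^esub>"
proof -
  interpret S: group "BijGroup (carrier Q)" by (rule group_BijGroup)
  have "\<one>\<^bsub>BijGroup (carrier Q)\<^esub> x = x" if "x \<in> carrier Q" for x
    using that by (simp add: BijGroup_def)
  then show ?thesis
    using assms by (simp add: good_involution_def trivial_quandle_def Let_def)
qed


lemma foldr_red_cons_snoc:
  assumes "reduced (w @ [c])"
  shows "foldr red_cons w [c] = w @ [c]"
  using foldr_red_cons_Nil[OF assms] by simp

lemma reduced_snoc:
  "reduced (w @ [z]) \<Longrightarrow> c \<noteq> inv_letter z \<Longrightarrow> reduced (w @ [z, c])"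
proof (induction w)
  case (Cons a w)
  then show ?case by (cases w) auto
qed simp

lemma snoc_eq_Cons_set:
  "w @ [c] = c # w \<Longrightarrow> set w \<subseteq> {c}"
  by (induction w) auto

text \<open>If the last letter of \<open>w\<close> is neither the generator \<open>y\<close> nor its inverse, then nothing cancels in
  \<open>w \<otimes> y\<close>. By comparing lengths, nothing cancels in \<open>y \<otimes> w\<close> either, so \<open>w @ [y] = y # w\<close> as words.
  Hence every letter of \<open>w\<close> is \<open>y\<close>, contrary to the choice of \<open>y\<close>. Such a choice of \<open>y\<close> is possible
  among any two distinct generators.\<close>

lemma commutes_two_letters_Nil:
  assumes red: "reduced w" and ab: "a \<noteq> b"
    and comm: "\<And>c. c \<in> {a, b} \<Longrightarrow> foldr red_cons w [(c, True)] = red_cons (c, True) w"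
  shows "w = []"
proof (rule ccontr)
  assume "w \<noteq> []"
  then obtain u z where w: "w = u @ [z]" by (metis rev_exhaust)
  obtain c where c: "c \<in> {a, b}" and cz: "c \<noteq> fst z" using ab by blast
  have "reduced (w @ [(c, True)])"
    using reduced_snoc[of u z "(c, True)"] red cz by (auto simp: w inv_letter_def)
  then have eq: "w @ [(c, True)] = red_cons (c, True) w"
    using foldr_red_cons_snoc comm[OF c] by metis
  then have "length (red_cons (c, True) w) = Suc (length w)"
    by (metis length_append_singleton)
  then have "red_cons (c, True) w = (c, True) # w"
    by (cases w) (auto split: if_splits)
  then have "set w \<subseteq> {(c, True)}"
    using eq by (intro snoc_eq_Cons_set) simp
  then show False using cz by (auto simp: w)
qed

text \<open>This is the commutativity of the infinite cyclic group. In the inductive step the first letter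
  of \<open>u\<close> is either \<open>(y, t)\<close> or its inverse, and multiplications by these two letters commute because
  each undoes the other.\<close>

lemma commutes_single_letter:
  assumes "reduced u" "u \<in> lists ({y} \<times> UNIV)"
  shows "foldr red_cons u [(y, t)] = red_cons (y, t) u"
  using assms
proof (induction u)
  case (Cons a u)
  then have u: "reduced u" by (auto dest: reduced_tl)
  have au: "a # u = red_cons a u"
    using Cons.prems(1) by (cases u) auto
  have IH: "foldr red_cons (a # u) [(y, t)] = red_cons a (red_cons (y, t) u)"
    using Cons u by simp
  from Cons.prems(2) consider "a = (y, t)" | "a = inv_letter (y, t)"
    by (cases a) (auto simp: inv_letter_def)
  then show ?case
  proof cases
    case 1
    then show ?thesis unfolding IH using au by simp
  next
    case 2
    then have "red_cons a (red_cons (y, t) u) = u" "red_cons (y, t) (red_cons a u) = u"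
      using red_cons_cancel[OF u, of "(y, t)"] red_cons_cancel[OF u, of a] by simp_all
    then show ?thesis using IH au by simp
  qed
qed simp

definition expsum :: "'a word \<Rightarrow> int"
  where "expsum w = (\<Sum>a\<leftarrow>w. if snd a then 1 else - 1)"

lemma expsum_red_cons: "expsum (red_cons a w) = (if snd a then 1 else - 1) + expsum w"
  by (cases w) (auto simp: expsum_def inv_letter_def)

lemma expsum_mult: "expsum (u \<otimes>\<^bsub>free_group Y\<^esub> v) = expsum u + expsum v"
proof (induction u)
  case Nil
  then show ?case by (simp add: free_group_def expsum_def)
next
  case (Cons a u)
  then show ?case by (simp add: free_group_def expsum_red_cons) (simp add: expsum_def)
qed

lemma expsum_conj:
  assumes "g \<in> carrier (free_group Y)"
  shows "expsum (g \<otimes>\<^bsub>free_group Y\<^esub> h \<otimes>\<^bsub>free_group Y\<^esub> inv\<^bsub>free_group Y\<^esub> g) = expsum h"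
proof -
  interpret group "free_group Y" by (rule group_free_group)
  have "expsum g + expsum (inv\<^bsub>free_group Y\<^esub> g) = expsum (\<one>\<^bsub>free_group Y\<^esub>)"
    using assms expsum_mult[of Y g "inv\<^bsub>free_group Y\<^esub> g"] by simp
  then show ?thesis
    by (simp add: expsum_mult) (simp add: free_group_def expsum_def)
qed


lemma carrier_free_quandle:
  "carrier (free_quandle Y) = {g \<otimes>\<^bsub>free_group Y\<^esub> generator y \<otimes>\<^bsub>free_group Y\<^esub> inv\<^bsub>free_group Y\<^esub> g |
    g y. g \<in> carrier (free_group Y) \<and> y \<in> Y}"
  by (simp add: free_quandle_def Let_def)

lemma symm_free_quandle:
  "\<s>\<^bsub>free_quandle Y\<^esub> = (\<lambda>g\<in>carrier (free_quandle Y). \<lambda>h\<in>carrier (free_quandle Y).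
    g \<otimes>\<^bsub>free_group Y\<^esub> h \<otimes>\<^bsub>free_group Y\<^esub> inv\<^bsub>free_group Y\<^esub> g)"
  by (simp add: free_quandle_def Let_def)

lemma free_quandle_closed:
  assumes "x \<in> carrier (free_quandle Y)"
  shows "x \<in> carrier (free_group Y)"
proof -
  interpret group "free_group Y" by (rule group_free_group)
  show ?thesis using assms by (auto simp: carrier_free_quandle generator_closed)
qed

lemma generator_in_free_quandle:
  assumes "y \<in> Y"
  shows "generator y \<in> carrier (free_quandle Y)"
proof -
  interpret group "free_group Y" by (rule group_free_group)
  have "generator y = \<one>\<^bsub>free_group Y\<^esub> \<otimes>\<^bsub>free_group Y\<^esub> generator y
      \<otimes>\<^bsub>free_group Y\<^esub> inv\<^bsub>free_group Y\<^esub> \<one>\<^bsub>free_group Y\<^esub>"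
    using generator_closed[OF assms] by simp
  then show ?thesis unfolding carrier_free_quandle using assms by blast
qed

lemma expsum_free_quandle:
  assumes "x \<in> carrier (free_quandle Y)"
  shows "expsum x = 1"
  using assms
  by (auto simp: carrier_free_quandle expsum_conj) (simp add: expsum_def generator_def)

lemma no_good_involution_free_quandle:
  assumes a: "a \<in> Y" and b: "b \<in> Y" and ab: "a \<noteq> b"
  shows "\<not> good_involution (free_quandle Y) \<rho>"
proof
  assume \<rho>: "good_involution (free_quandle Y) \<rho>"
  define F where "F = free_group Y"
  interpret F: group F unfolding F_def by (rule group_free_group)
  interpret quandle "free_quandle Y" by (rule quandle_free_quandle)
  let ?x = "generator a"
  have x: "?x \<in> carrier (free_quandle Y)" by (rule generator_in_free_quandle[OF a])
  have \<rho>x: "\<rho> ?x \<in> carrier (free_quandle Y)" by (rule good_involution_inverse(1)[OF \<rho> x])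
  have xF: "?x \<in> carrier F" and \<rho>xF: "\<rho> ?x \<in> carrier F"
    using x \<rho>x by (auto simp: F_def intro: free_quandle_closed)
  define g where "g = \<rho> ?x \<otimes>\<^bsub>F\<^esub> ?x"
  have g: "g \<in> carrier F" using xF \<rho>xF by (simp add: g_def)
  have comm: "g \<otimes>\<^bsub>F\<^esub> h = h \<otimes>\<^bsub>F\<^esub> g" if h: "h \<in> carrier (free_quandle Y)" for h
  proof -
    have hF: "h \<in> carrier F" using h by (auto simp: F_def intro: free_quandle_closed)
    have sh: "\<s>\<^bsub>free_quandle Y\<^esub> ?x h = ?x \<otimes>\<^bsub>F\<^esub> h \<otimes>\<^bsub>F\<^esub> inv\<^bsub>F\<^esub> ?x"
      using x h by (simp add: symm_free_quandle F_def)
    have "\<s>\<^bsub>free_quandle Y\<^esub> ?x h \<in> carrier (free_quandle Y)"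
      using symm_closed[OF x] h Bij_imp_funcset by (fastforce simp: BijGroup_def)
    then have "h = \<rho> ?x \<otimes>\<^bsub>F\<^esub> (?x \<otimes>\<^bsub>F\<^esub> h \<otimes>\<^bsub>F\<^esub> inv\<^bsub>F\<^esub> ?x) \<otimes>\<^bsub>F\<^esub> inv\<^bsub>F\<^esub> \<rho> ?x"
      using good_involution_inverse(2)[OF \<rho> x h] \<rho>x unfolding sh
      by (simp add: symm_free_quandle F_def)
    also have "\<dots> = g \<otimes>\<^bsub>F\<^esub> h \<otimes>\<^bsub>F\<^esub> inv\<^bsub>F\<^esub> g"
      using xF \<rho>xF hF by (simp add: g_def F.m_assoc F.inv_mult_group)
    finally show ?thesis
      using g hF by (metis F.inv_closed F.inv_solve_right F.m_closed)
  qed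
  have "g = []"
  proof (rule commutes_two_letters_Nil[OF _ ab])
    show "reduced g" using g by (simp add: F_def free_group_def)
    show "foldr red_cons g [(c, True)] = red_cons (c, True) g" if "c \<in> {a, b}" for c
      using comm[OF generator_in_free_quandle, of c] that a b
      by (auto simp: F_def free_group_def generator_def)
  qed
  moreover have "expsum g = 2"
    using expsum_free_quandle[OF x] expsum_free_quandle[OF \<rho>x]
    by (simp add: g_def F_def expsum_mult)
  ultimately show False by (simp add: expsum_def)
qed

lemma trivial_free_quandle:
  assumes eq: "\<And>a b. a \<in> Y \<Longrightarrow> b \<in> Y \<Longrightarrow> a = b"
  shows "trivial_quandle (free_quandle Y)"
proof -
  interpret F: group "free_group Y" by (rule group_free_group)
  have conj: "g \<otimes>\<^bsub>free_group Y\<^esub> generator y \<otimes>\<^bsub>free_group Y\<^esub> inv\<^bsub>free_group Y\<^esub> g = generator y"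
    if g: "g \<in> carrier (free_group Y)" and y: "y \<in> Y" for g y
  proof -
    have Y: "Y = {y}" using eq y by blast
    have "g \<otimes>\<^bsub>free_group Y\<^esub> generator y = generator y \<otimes>\<^bsub>free_group Y\<^esub> g"
      using g commutes_single_letter[of g y True] by (simp add: free_group_def generator_def Y)
    then show ?thesis
      using g generator_closed[OF y] by (simp add: F.m_assoc)
  qed
  have "g \<otimes>\<^bsub>free_group Y\<^esub> h \<otimes>\<^bsub>free_group Y\<^esub> inv\<^bsub>free_group Y\<^esub> g = h"
    if "g \<in> carrier (free_group Y)" "h \<in> carrier (free_quandle Y)" for g h
    using that by (auto simp: carrier_free_quandle conj)
  then show ?thesis
    by (auto simp: trivial_quandle_def BijGroup_def symm_free_quandle free_quandle_closed
        intro!: restrict_ext)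
qed

theorem mainTheorem5:
  fixes Y :: "'a set"
  shows "((infinite Y \<or> card Y \<ge> 2) \<longleftrightarrow> \<not> trivial_quandle (free_quandle Y)) \<and>
    ((infinite Y \<or> card Y \<ge> 2) \<longrightarrow> Good (free_quandle Y) = {})"
proof (cases "\<exists>a\<in>Y. \<exists>b\<in>Y. a \<noteq> b")
  case True
  then have none: "\<not> good_involution (free_quandle Y) \<rho>" for \<rho>
    using no_good_involution_free_quandle by metis
  then have "\<not> trivial_quandle (free_quandle Y)"
    using good_involution_trivial_quandle by blast
  moreover have "infinite Y \<or> card Y \<ge> 2"
    using True card_le_Suc0_iff_eq[of Y] by fastforce
  ultimately show ?thesis using none by (simp add: Good_def)
next
  case False
  then have eq: "a = b" if "a \<in> Y" "b \<in> Y" for a b using that by blast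
  then have "Y \<subseteq> {a}" if "a \<in> Y" for a using that by blast
  then have "finite Y" by (metis all_not_in_conv finite.emptyI finite_insert finite_subset)
  moreover from this have "\<not> card Y \<ge> 2"
    using card_le_Suc0_iff_eq[of Y] eq by fastforce
  ultimately show ?thesis using trivial_free_quandle[OF eq] by blast
qed

end
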